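(* Let $(Z_n)_{n\ge0}$ be a BPIRE (as in the context) with offspring p.g.f. $\varphi_n$ and $M_n$ immigrants in generation $n$, which is an irreducible Markov chain under $Q$ (on state space $\mathbb{N}$ or $\mathbb{N}_0$). Assume: (1) $(\varphi_n,M_n)_{n\in\mathbb{N}}$ is i.i.d. under $Q$; (2) with $\mu_n:=\varphi_n'(1)$, $E_Q[|\log\mu_1|^2]<\infty$, $E_Q[\log\mu_1]=0$ and $Q[\mu_1=1]<1$; (3) $E_Q[(\log_+ M_1)^{2+\epsilon}]<\infty$ for some $\epsilon>0$. Then $(Z_n)_{n\ge0}$ is recurrent.
   Context: Branching process in random environment with immigration (BPIRE) with deterministic-given-environment immigration: the environment is a sequence $(\varphi_n,M_n)_{n\in\mathbb{N}}$ of pairs, where $\varphi_n$ is a (random) probability generating function of a distribution on $\mathbb{N}_0$ and $M_n$ is an $\mathbb{N}_0$-valued random variable, defined on a probability space with measure $Q$. Write $Q_{(\varphi,M)}:=Q[\cdot\mid(\varphi_n,M_n)_{n}]$. Conditionally on the environment, $\{\xi^{(n)}_j: j,n\in\mathbb{N}\}$ are independent, with $\xi^{(n)}_j$ having p.g.f. $\varphi_n$. Set $Z_0:=0$ and $Z_n:=\xi^{(n)}_1+\dots+\xi^{(n)}_{Z_{n-1}}+M_n$ for $n\ge1$ ($\xi^{(n)}_j$ is the number of offspring of the $j$-th individual of generation $n-1$, $M_n$ the number of immigrants in generation $n$). Under $Q$, $(Z_n)$ is a time-homogeneous Markov chain; recurrence/transience refer to this chain. $\log_+x=\max(\log x,0)$.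 *)

theory Defs
  imports "HOL-Probability.Probability"
begin

text \<open>Offspring distributions are represented by their probability vectors
  p :: nat \<Rightarrow> real (p k = probability of k offspring), the p.g.f. being
  \<open>\<lambda>s. \<Sum>k. p k * s ^ k\<close>.\<close>

definition seq_conv :: "(nat \<Rightarrow> real) \<Rightarrow> (nat \<Rightarrow> real) \<Rightarrow> nat \<Rightarrow> real" where
  "seq_conv f g n = (\<Sum>i\<le>n. f i * g (n - i))"

text \<open>conv_pow p x = law of the sum of x independent p-distributed variables.\<close>
fun conv_pow :: "(nat \<Rightarrow> real) \<Rightarrow> nat \<Rightarrow> nat \<Rightarrow> real" where
  "conv_pow p 0 = (\<lambda>n. if n = 0 then 1 else 0)"
| "conv_pow p (Suc x) = seq_conv (conv_pow p x) p"

text \<open>Quenched one-step transition probability in environment (p, m):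
  law of \<open>\<xi>\<^sub>1 + \<dots> + \<xi>\<^sub>x + m\<close>.\<close>
definition quenched_step :: "(nat \<Rightarrow> real) \<Rightarrow> nat \<Rightarrow> nat \<Rightarrow> nat \<Rightarrow> real" where
  "quenched_step p m x y = (if m \<le> y then conv_pow p x (y - m) else 0)"

text \<open>Annealed transition kernel of the BPIRE under Q (environment of generation n;
  by the i.i.d. assumption it does not depend on n, we use generation 1).\<close>
definition bpire_kernel :: "'w measure \<Rightarrow> (nat \<Rightarrow> 'w \<Rightarrow> nat \<Rightarrow> real) \<Rightarrow> (nat \<Rightarrow> 'w \<Rightarrow> nat)
      \<Rightarrow> nat \<Rightarrow> nat \<Rightarrow> real" where
  "bpire_kernel Q p M x y = (\<integral>\<omega>. quenched_step (p 1 \<omega>) (M 1 \<omega>) x y \<partial>Q)"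

text \<open>Irreducibility of a Markov kernel on a state space S.\<close>
definition irreducible_on :: "nat set \<Rightarrow> (nat \<Rightarrow> nat \<Rightarrow> real) \<Rightarrow> bool" where
  "irreducible_on S K \<longleftrightarrow>
     (\<forall>x\<in>S. \<forall>y. y \<notin> S \<longrightarrow> K x y = 0) \<and>
     (\<forall>x\<in>S. \<forall>y\<in>S. (x, y) \<in> {(a, b). 0 < K a b}\<^sup>*)"

text \<open>first_hit K n x y = probability, starting in x, that the first visit to y
  (at a time \<ge> 1) happens at time n+1.\<close>
fun first_hit :: "(nat \<Rightarrow> nat \<Rightarrow> real) \<Rightarrow> nat \<Rightarrow> nat \<Rightarrow> nat \<Rightarrow> real" where
  "first_hit K 0 x y = K x y"
| "first_hit K (Suc n) x y = (\<Sum>z. if z = y then 0 else K x z * first_hit K n z y)"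

text \<open>A state x is recurrent iff the chain started at x returns to x with probability 1.\<close>
definition recurrent_state :: "(nat \<Rightarrow> nat \<Rightarrow> real) \<Rightarrow> nat \<Rightarrow> bool" where
  "recurrent_state K x \<longleftrightarrow> (\<Sum>n. first_hit K n x x) = 1"

definition log_plus :: "real \<Rightarrow> real" where
  "log_plus x = (if x \<le> 1 then 0 else ln x)"

definition offspring_mean :: "(nat \<Rightarrow> real) \<Rightarrow> real" where
  "offspring_mean p = (\<Sum>k. real k * p k)"

end

theory Submission
  imports Defs "HOL-Real_Asymp.Real_Asymp"
begin

text \<open>The function \<open>f x = \<surd>(ln (1 + x))\<close> is superharmonic for the annealed kernel outside a finite
  set. Conditionally on the environment \<open>(\<phi>, m)\<close> with mean \<open>\<mu>\<close>, Jensen's inequality for the concave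
  \<open>f\<close> bounds the expectation of \<open>f\<close> after one step by \<open>f (x \<mu> + m)\<close>. On the scale \<open>ln x\<close> this is a
  step of a centred random walk with increment \<open>ln \<mu>\<close>, perturbed by the immigration only by
  \<open>o(1 / ln x)\<close> on average, and the strict concavity of the square root then outweighs the
  perturbation. Since \<open>f\<close> tends to infinity, recurrence follows from Foster's criterion.\<close>

subsection \<open>A Foster criterion for recurrence\<close>

text \<open>The deficits \<open>m - w z\<close> are nonnegative wherever \<open>k\<close> has mass,
  and their \<open>k\<close>-average \<open>m - s\<close> is at most 0, so each charged deficit
  vanishes.\<close>

lemma subharmonic_max_propagates:
  fixes k w :: "nat \<Rightarrow> real"
  assumes nonneg: "\<And>z. 0 \<le> k z" and sums1: "k sums 1"
    and le: "\<And>z. 0 < k z \<Longrightarrow> w z \<le> m"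
    and sums: "(\<lambda>z. k z * w z) sums s" and "m \<le> s" and pos: "0 < k z"
  shows "w z = m"
proof -
  have S: "(\<lambda>z. k z * (m - w z)) sums (m - s)"
    using sums_diff[OF sums_mult2[OF sums1, of m] sums] by (simp add: algebra_simps)
  have nn: "0 \<le> k z * (m - w z)" for z
    using nonneg[of z] le[of z] by (cases "k z = 0") auto
  have "k z * (m - w z) \<le> m - s"
    using sum_le_suminf[of "\<lambda>z. k z * (m - w z)" "{z}"] S nn
    by (auto simp: sums_iff)
  then have "k z * (m - w z) = 0" using nn[of z] \<open>m \<le> s\<close> by linarith
  then show ?thesis using pos by auto
qed

section \<open>First-passage probabilities of a stochastic kernel\<close>

locale stochastic_kernel =
  fixes K :: "nat \<Rightarrow> nat \<Rightarrow> real"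
  assumes nonneg: "\<And>x z. 0 \<le> K x z" and sums1: "\<And>x. K x sums 1"
begin

text \<open>The recursion uses \<open>suminf\<close>, which carries information only for convergent
  series. The bound at level \<open>n\<close> makes the series at level \<open>Suc n\<close>
  summable by comparison with \<open>K x\<close>, and this in turn yields the next bound.\<close>

lemma first_hit_bounded_and_sums:
  shows "first_hit K n x y \<in> {0..1} \<and>
    (\<lambda>z. if z = y then 0 else K x z * first_hit K n z y) sums first_hit K (Suc n) x y"
proof -
  have sums: "(\<lambda>z. if z = y then 0 else K x z * first_hit K n z y) sums first_hit K (Suc n) x y"
    if "\<And>z. first_hit K n z y \<in> {0..1}" for n x
  proof -
    have "summable (\<lambda>z. if z = y then 0 else K x z * first_hit K n z y)"
      by (rule summable_comparison_test[OF _ sums_summable[OF sums1[of x]]])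
         (use that nonneg in \<open>auto simp: mult_left_le abs_mult intro!: exI[of _ 0]\<close>)
    then show ?thesis by (simp add: summable_sums)
  qed
  have bounded: "first_hit K n x y \<in> {0..1}" for n x
  proof (induction n arbitrary: x)
    case 0
    have "K x y \<le> 1"
      using sum_le_suminf[of "K x" "{y}"] sums1[of x] nonneg by (auto simp: sums_iff)
    then show ?case by (simp add: nonneg)
  next
    case (Suc n)
    have Q: "(\<lambda>z. if z = y then 0 else K x z * first_hit K n z y) sums first_hit K (Suc n) x y"
      using Suc by (rule sums)
    have b: "0 \<le> first_hit K n z y" "first_hit K n z y \<le> 1" for z
      using Suc[of z] by auto
    have "first_hit K (Suc n) x y \<le> 1"
      by (rule sums_le[OF _ Q sums1[of x]]) (use b nonneg in \<open>auto simp: mult_left_le\<close>)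
    moreover have "0 \<le> first_hit K (Suc n) x y"
      by (rule sums_le[OF _ sums_zero Q]) (use b nonneg in auto)
    ultimately show ?case by simp
  qed
  show ?thesis using bounded sums by blast
qed

text \<open>First-step analysis of a visit to \<open>y\<close> within a finite horizon: the value 1
  at \<open>z = y\<close> records that the first step has already hit the target, and otherwise one
  time unit of the horizon is used up.\<close>

lemma sum_first_hit_bounded_and_sums:
  shows "(\<Sum>n<N. first_hit K n x y) \<in> {0..1} \<and>
    (\<lambda>z. K x z * (if z = y then 1 else \<Sum>n<N. first_hit K n z y)) sums
      (\<Sum>n<Suc N. first_hit K n x y)"
proof (induction N arbitrary: x)
  case 0
  have "(\<lambda>z. if z = y then K x z else 0) sums K x y"
    using sums_single[of y "K x"] by simp
  then show ?case by (simp add: if_distrib cong: if_cong)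
next
  case (Suc N)
  have b: "0 \<le> (\<Sum>n<N. first_hit K n z y)" "(\<Sum>n<N. first_hit K n z y) \<le> 1" for z
    using Suc[of z] by auto
  have Q: "(\<lambda>z. K x z * (if z = y then 1 else \<Sum>n<N. first_hit K n z y)) sums
      (\<Sum>n<Suc N. first_hit K n x y)"
    using Suc by blast
  have le: "(\<Sum>n<Suc N. first_hit K n x y) \<le> 1"
    by (rule sums_le[OF _ Q sums1[of x]]) (use b nonneg in \<open>auto simp: mult_left_le\<close>)
  have ge: "0 \<le> (\<Sum>n<Suc N. first_hit K n x y)"
    by (rule sums_le[OF _ sums_zero Q]) (use b nonneg in auto)
  have eq: "K x z * (if z = y then 1 else \<Sum>n<N. first_hit K n z y)
        + (if z = y then 0 else K x z * first_hit K N z y)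
      = K x z * (if z = y then 1 else \<Sum>n<Suc N. first_hit K n z y)" for z
    by (simp add: distrib_left)
  show ?case
    using sums_add[OF Q conjunct2[OF first_hit_bounded_and_sums[where n=N and x=x and y=y]]]
      le ge unfolding eq by simp
qed

text \<open>The horizon \<open>N\<close> is sent to infinity in the finite first-step equation;
  Tannery's theorem applies since all terms are dominated by \<open>K x\<close>.\<close>

lemma first_hit_series:
  shows "(\<Sum>n. first_hit K n x y) \<in> {0..1}"
    and "(\<lambda>z. K x z * (if z = y then 1 else \<Sum>n. first_hit K n z y)) sums
      (\<Sum>n. first_hit K n x y)"
proof -
  note * = sum_first_hit_bounded_and_sums[where y = y]
  have fh: "0 \<le> first_hit K n x y" for n x
    using first_hit_bounded_and_sums by auto
  have b: "0 \<le> (\<Sum>n<N. first_hit K n z y)" "(\<Sum>n<N. first_hit K n z y) \<le> 1" for z N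
    using *[of z N] by auto
  have summ: "summable (\<lambda>n. first_hit K n x y)" for x
    by (rule summableI_nonneg_bounded[of _ 1]) (use fh b in auto)
  show bd: "(\<Sum>n. first_hit K n x y) \<in> {0..1}" for x
    using suminf_nonneg[OF summ fh] suminf_le_const[OF summ b(2)] by simp
  have bd': "0 \<le> (\<Sum>n. first_hit K n x y)" "(\<Sum>n. first_hit K n x y) \<le> 1" for x
    using bd[of x] by auto
  define g where "g N z = (if z = y then 1 else \<Sum>n<N. first_hit K n z y)" for N z
  define h where "h z = (if z = y then 1 else \<Sum>n. first_hit K n z y)" for z
  have "(\<lambda>N. g N z) \<longlonglongrightarrow> h z" for z
    unfolding g_def h_def using summable_LIMSEQ[OF summ[of z]] by auto
  then have lim: "(\<lambda>N. K x z * g N z) \<longlonglongrightarrow> K x z * h z" for z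
    by (intro tendsto_intros)
  have sumK: "summable (K x)" using sums1 by (rule sums_summable)
  have hs: "summable (\<lambda>z. K x z * h z)"
    by (rule summable_comparison_test[OF _ sumK])
       (use bd' nonneg in \<open>auto simp: h_def mult_left_le abs_mult intro!: exI[of _ 0]\<close>)
  have "(\<lambda>N. \<Sum>z. K x z * g N z) \<longlonglongrightarrow> (\<Sum>z. K x z * h z)"
    by (intro tannerys_theorem[OF lim _ sumK, THEN conjunct2, THEN conjunct2])
       (use b nonneg in \<open>auto simp: g_def mult_left_le abs_mult intro!: always_eventually\<close>)
  moreover have "(\<lambda>N. \<Sum>z. K x z * g N z) = (\<lambda>N. \<Sum>n<Suc N. first_hit K n x y)"
    unfolding g_def using * by (auto simp: sums_iff)
  moreover have "(\<lambda>N. \<Sum>n<Suc N. first_hit K n x y) \<longlonglongrightarrow> (\<Sum>n. first_hit K n x y)"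
    using summable_LIMSEQ[OF summ] by (rule LIMSEQ_Suc)
  ultimately have "(\<Sum>z. K x z * h z) = (\<Sum>n. first_hit K n x y)"
    using LIMSEQ_unique by metis
  with hs show "(\<lambda>z. K x z * (if z = y then 1 else \<Sum>n. first_hit K n z y)) sums
      (\<Sum>n. first_hit K n x y)"
    unfolding h_def by (simp add: sums_iff)
qed

text \<open>Let \<open>w x\<close> be the probability of never visiting \<open>y\<close> from \<open>x\<close>, with \<open>w y = 0\<close>. It is
  bounded and subharmonic everywhere, and \<open>w - \<epsilon> f\<close> is subharmonic off a finite set and tends to
  \<open>-\<infinity>\<close>. By the maximum principle \<open>w\<close> is bounded by its maximum over that finite set, so the
  maximum is attained; it propagates along a path to \<open>y\<close>, where \<open>w\<close> vanishes.\<close>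

theorem foster_recurrence:
  assumes irred: "irreducible_on S K" and "y \<in> S"
    and f_nonneg: "\<And>x. 0 \<le> f x" and f_lim: "filterlim f at_top sequentially"
    and f_super: "\<And>x. x0 \<le> x \<Longrightarrow> summable (\<lambda>z. K x z * f z) \<and> (\<Sum>z. K x z * f z) \<le> f x"
  shows "recurrent_state K y"
proof -
  have closed: "z \<in> S" if "x \<in> S" "0 < K x z" for x z
    using irred that unfolding irreducible_on_def by force
  have reach: "(x, z) \<in> {(a, b). 0 < K a b}\<^sup>*" if "x \<in> S" "z \<in> S" for x z
    using irred that unfolding irreducible_on_def by blast
  define u where "u x = (\<Sum>n. first_hit K n x y)" for x
  \<comment> \<open>Setting \<open>w y = 0\<close> instead of \<open>1 - u y\<close> turns
    \<open>1 - u x\<close> into the one-step average of \<open>w\<close> for every \<open>x\<close>,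
    including \<open>y\<close>.\<close>
  define w where "w x = (if x = y then 0 else 1 - u x)" for x
  have u: "0 \<le> u x" "u x \<le> 1" for x
    using first_hit_series(1)[of x y] by (auto simp: u_def)
  have w01: "0 \<le> w x" "w x \<le> 1" for x using u by (auto simp: w_def)
  have Kw: "(\<lambda>z. K x z * w z) sums (1 - u x)" for x
  proof -
    have "(\<lambda>z. K x z * (if z = y then 1 else u z)) sums u x"
      using first_hit_series(2)[of x y] unfolding u_def .
    from sums_diff[OF sums1[of x] this] show ?thesis
      by (rule sums_cong[THEN iffD1, rotated]) (auto simp: w_def algebra_simps)
  qed
  have w_sub: "w x \<le> 1 - u x" for x using u by (auto simp: w_def)
  \<comment> \<open>Inserting \<open>y\<close> keeps \<open>A\<close> nonempty and ensures that a
    path to \<open>y\<close> ends in \<open>A\<close>.\<close>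
  define A where "A = insert y (S \<inter> {..<x0})"
  have A: "finite A" "A \<subseteq> S" "y \<in> A" using \<open>y \<in> S\<close> by (auto simp: A_def)
  have max_on_A: "\<exists>a\<in>A. w x - \<epsilon> * f x \<le> w a - \<epsilon> * f a" if "\<epsilon> > 0" "x \<in> S" for \<epsilon> x
  proof -
    define g where "g z = w z - \<epsilon> * f z" for z
    \<comment> \<open>Since \<open>w\<close> is at most 1 and \<open>f\<close> diverges,
      \<open>g\<close> drops below \<open>g y\<close> outside a finite set, so its supremum over
      \<open>S\<close> is attained.\<close>
    have "eventually (\<lambda>z. f z \<ge> (1 - g y) / \<epsilon>) sequentially"
      using f_lim by (simp add: filterlim_at_top)
    then obtain N where N: "f z \<ge> (1 - g y) / \<epsilon>" if "z \<ge> N" for z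
      by (auto simp: eventually_sequentially)
    have far: "g z \<le> g y" if "z \<ge> N" for z
    proof -
      have "1 - g y \<le> \<epsilon> * f z" using N[OF that] \<open>\<epsilon> > 0\<close> by (simp add: field_simps)
      then show ?thesis using w01[of z] by (simp add: g_def)
    qed
    define B where "B = insert y (S \<inter> {..<N})"
    have "finite (g ` B)" "g ` B \<noteq> {}" by (auto simp: B_def)
    from Max_in[OF this] obtain b where b: "b \<in> B" "g b = Max (g ` B)" by auto
    have bmax: "g z \<le> g b" if "z \<in> S" for z
    proof (cases "z < N")
      case True
      then show ?thesis using that b(2) by (auto simp: B_def)
    next
      case False
      then have "g z \<le> g y" using far by simp
      also have "g y \<le> g b" using b(2) by (auto simp: B_def)
      finally show ?thesis .
    qed
    have "b \<in> S" using b(1) \<open>y \<in> S\<close> by (auto simp: B_def)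
    have "\<exists>a\<in>A. g a = g b"
    proof (rule ccontr)
      assume none: "\<not> (\<exists>a\<in>A. g a = g b)"
      \<comment> \<open>Under \<open>none\<close>, every maximum point of \<open>g\<close> in
        \<open>S\<close> lies at or above \<open>x0\<close>, where \<open>g\<close> is subharmonic.
        The maximal value then spreads along a path from \<open>b\<close> to \<open>y\<close>,
        contradicting that \<open>y\<close> is in \<open>A\<close>.\<close>
      have propagate: "z' \<in> S \<and> g z' = g b" if z: "z \<in> S" "g z = g b" and "0 < K z z'" for z z'
      proof
        show "z' \<in> S" using closed z(1) \<open>0 < K z z'\<close> by blast
        have "z \<notin> A" using none z(2) by blast
        then have "x0 \<le> z" using z(1) by (auto simp: A_def)
        then have fs: "summable (\<lambda>z'. K z z' * f z')" "(\<Sum>z'. K z z' * f z') \<le> f z"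
          using f_super by auto
        have "(\<lambda>z'. K z z' * g z') sums (1 - u z - \<epsilon> * (\<Sum>z'. K z z' * f z'))"
          using sums_diff[OF Kw[of z] sums_mult[OF summable_sums[OF fs(1)], of \<epsilon>]]
          by (simp add: g_def algebra_simps)
        moreover have "g b \<le> 1 - u z - \<epsilon> * (\<Sum>z'. K z z' * f z')"
          using z(2) w_sub[of z] mult_left_mono[OF fs(2), of \<epsilon>] \<open>\<epsilon> > 0\<close>
          unfolding g_def by linarith
        moreover have "g z'' \<le> g b" if "0 < K z z''" for z''
          using closed[OF z(1) that] by (rule bmax)
        ultimately show "g z' = g b"
          using subharmonic_max_propagates[of "K z" g "g b"] nonneg sums1 \<open>0 < K z z'\<close> by blast
      qed
      have "y \<in> S \<and> g y = g b"
        using reach[OF \<open>b \<in> S\<close> \<open>y \<in> S\<close>]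
      proof (induction rule: rtrancl_induct)
        case base
        then show ?case using \<open>b \<in> S\<close> by blast
      next
        case (step z z')
        then show ?case using propagate[of z z'] by blast
      qed
      then show False using none A by blast
    qed
    then obtain a where "a \<in> A" "g a = g b" by blast
    then show ?thesis using bmax[OF \<open>x \<in> S\<close>] unfolding g_def by metis
  qed
  define m where "m = Max (w ` A)"
  have wA: "w a \<le> m" if "a \<in> A" for a using A that by (simp add: m_def)
  have wm: "w x \<le> m" if "x \<in> S" for x
  proof (rule field_le_epsilon)
    fix e :: real assume "e > 0"
    \<comment> \<open>As \<open>A\<close> does not depend on \<open>\<epsilon>\<close>, the latter
      may be chosen for the given \<open>x\<close>; the summand 1 covers the case
      \<open>f x = 0\<close>.\<close>
    define \<epsilon> where "\<epsilon> = e / (1 + f x)"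
    have "\<epsilon> > 0" using \<open>e > 0\<close> f_nonneg[of x] by (simp add: \<epsilon>_def)
    then obtain a where a: "a \<in> A" "w x - \<epsilon> * f x \<le> w a - \<epsilon> * f a"
      using max_on_A \<open>x \<in> S\<close> by blast
    have "\<epsilon> * f x \<le> e" using \<open>e > 0\<close> f_nonneg[of x] by (simp add: \<epsilon>_def field_simps)
    moreover have "0 \<le> \<epsilon> * f a" using \<open>\<epsilon> > 0\<close> f_nonneg[of a] by simp
    ultimately show "w x \<le> m + e" using a wA[OF a(1)] by linarith
  qed
  have "m \<in> w ` A" unfolding m_def by (rule Max_in) (use A in auto)
  then obtain a where a: "a \<in> A" "w a = m" by auto
  have "a \<in> S" using a A by blast
  \<comment> \<open>Here \<open>w\<close> itself is propagated; it is subharmonic everywhere, so the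
    path may run through \<open>A\<close>.\<close>
  have "y \<in> S \<and> w y = m"
    using reach[OF \<open>a \<in> S\<close> \<open>y \<in> S\<close>]
  proof (induction rule: rtrancl_induct)
    case base
    then show ?case using a \<open>a \<in> S\<close> by simp
  next
    case (step z z')
    then have z: "z \<in> S" "w z = m" "0 < K z z'" by auto
    have "w z' = m"
      by (rule subharmonic_max_propagates[OF _ sums1[of z] _ Kw[of z] _ z(3)])
         (use nonneg w_sub[of z] z closed wm in auto)
    then show ?case using closed z by blast
  qed
  then have "m = 0" by (simp add: w_def)
  \<comment> \<open>With maximum 0 on the closed class \<open>S\<close>, \<open>w\<close> vanishes
    at every successor of \<open>y\<close>; hence its average \<open>1 - u y\<close> is 0.\<close>
  then have zero: "K y z * w z = 0" for z
    using nonneg[of y z] wm[of z] w01(1)[of z] closed[OF \<open>y \<in> S\<close>, of z] by (cases "K y z = 0") auto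
  have "(\<lambda>_. 0) sums (1 - u y)" using Kw[of y] unfolding zero .
  then have "1 - u y = 0" using sums_unique2 sums_zero by blast
  then show ?thesis by (simp add: recurrent_state_def u_def)
qed

end

subsection \<open>The quenched step\<close>

lemma seq_conv_nonneg: "(\<And>k. 0 \<le> f k) \<Longrightarrow> (\<And>k. 0 \<le> g k) \<Longrightarrow> 0 \<le> seq_conv f g n"
  by (simp add: seq_conv_def sum_nonneg)

lemma seq_conv_sums:
  assumes "\<And>k. 0 \<le> f k" "\<And>k. 0 \<le> g k" "f sums a" "g sums b"
  shows "seq_conv f g sums (a * b)"
  using Cauchy_product_sums[of f g] assms unfolding seq_conv_def[abs_def]
  by (simp add: sums_iff)

lemma conv_pow_nonneg: "(\<And>k. 0 \<le> p k) \<Longrightarrow> 0 \<le> conv_pow p x n"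
  by (induction x arbitrary: n) (auto intro: seq_conv_nonneg)

lemma conv_pow_sums:
  assumes "\<And>k. 0 \<le> p k" "p sums 1"
  shows "conv_pow p x sums 1"
proof (induction x)
  case 0
  then show ?case using sums_single[of 0 "\<lambda>_. 1::real"] by simp
next
  case (Suc x)
  then show ?case using seq_conv_sums[of "conv_pow p x" p 1 1] assms conv_pow_nonneg by simp
qed

text \<open>Additivity of the mean under convolution: in each product term the weight
  \<open>n\<close> splits as \<open>i + (n - i)\<close>, giving two convolutions whose sums are
  known.\<close>

lemma conv_pow_mean_sums:
  assumes "\<And>k. 0 \<le> p k" "p sums 1" and mean: "(\<lambda>k. real k * p k) sums m"
  shows "(\<lambda>k. real k * conv_pow p x k) sums (real x * m)"
proof (induction x)
  case 0
  have "(\<lambda>k. real k * conv_pow p 0 k) = (\<lambda>_. 0)" by auto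
  then show ?case by simp
next
  case (Suc x)
  let ?c = "conv_pow p x"
  have nn: "0 \<le> ?c k" for k using assms conv_pow_nonneg by blast
  have "seq_conv (\<lambda>k. real k * ?c k) p sums (real x * m * 1)"
    by (rule seq_conv_sums) (use assms nn Suc in auto)
  moreover have "seq_conv ?c (\<lambda>k. real k * p k) sums (1 * m)"
    by (rule seq_conv_sums) (use assms nn conv_pow_sums in auto)
  ultimately have "(\<lambda>n. seq_conv (\<lambda>k. real k * ?c k) p n + seq_conv ?c (\<lambda>k. real k * p k) n)
      sums (real x * m * 1 + 1 * m)"
    by (rule sums_add)
  moreover have "seq_conv (\<lambda>k. real k * ?c k) p n + seq_conv ?c (\<lambda>k. real k * p k) n
      = real n * conv_pow p (Suc x) n" for n
    unfolding conv_pow.simps seq_conv_def sum.distrib[symmetric] sum_distrib_left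
    by (intro sum.cong refl) (simp add: of_nat_diff algebra_simps)
  ultimately show ?case by (simp add: algebra_simps del: conv_pow.simps)
qed

lemma quenched_step_shift: "quenched_step p m x (z + m) = conv_pow p x z"
  by (simp add: quenched_step_def)

lemma quenched_step_nonneg: "(\<And>k. 0 \<le> p k) \<Longrightarrow> 0 \<le> quenched_step p m x z"
  by (simp add: quenched_step_def conv_pow_nonneg)

lemma quenched_step_sums:
  assumes "\<And>k. 0 \<le> p k" "p sums 1"
  shows "quenched_step p m x sums 1"
proof -
  have "(\<lambda>z. quenched_step p m x (z + m)) sums 1"
    using conv_pow_sums[OF assms] by (simp add: quenched_step_shift)
  then show ?thesis
    by (subst (asm) sums_iff_shift) (simp add: quenched_step_def)
qed

lemma quenched_step_mean_sums:
  assumes "\<And>k. 0 \<le> p k" "p sums 1" "(\<lambda>k. real k * p k) sums \<mu>"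
  shows "(\<lambda>z. quenched_step p m x z * real z) sums (real x * \<mu> + real m)"
proof -
  have "(\<lambda>z. real z * conv_pow p x z + real m * conv_pow p x z) sums (real x * \<mu> + real m * 1)"
    using assms by (intro sums_add sums_mult conv_pow_mean_sums conv_pow_sums)
  then have "(\<lambda>z. quenched_step p m x (z + m) * real (z + m)) sums (real x * \<mu> + real m)"
    by (simp add: quenched_step_shift algebra_simps)
  then show ?thesis
    by (subst (asm) sums_iff_shift) (simp add: quenched_step_def)
qed

section \<open>Tangent-line bounds and Jensen's inequality\<close>

lemma sqrt_le_tangent:
  fixes s t :: real
  assumes "0 < s" "0 \<le> t"
  shows "sqrt t \<le> sqrt s + (t - s) / (2 * sqrt s)"
proof -
  have "2 * sqrt s * sqrt t \<le> s + t"
    using sum_squares_bound[of "sqrt s" "sqrt t"] assms by simp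
  moreover have "(sqrt t - sqrt s) * (2 * sqrt s) = 2 * sqrt s * sqrt t - 2 * (sqrt s * sqrt s)"
    by (simp add: algebra_simps)
  moreover have "sqrt s * sqrt s = s" using assms by simp
  ultimately have "(sqrt t - sqrt s) * (2 * sqrt s) \<le> t - s" by linarith
  then have "sqrt t - sqrt s \<le> (t - s) / (2 * sqrt s)"
    using assms by (subst pos_le_divide_eq) auto
  then show ?thesis by simp
qed

lemma sqrt_ln_le_tangent:
  fixes a z :: real
  assumes "0 < a" "0 \<le> z"
  shows "sqrt (ln (1 + z)) \<le> sqrt (ln (1 + a)) + (z - a) / ((1 + a) * (2 * sqrt (ln (1 + a))))"
proof -
  have "ln ((1 + z) / (1 + a)) \<le> (1 + z) / (1 + a) - 1"
    using assms by (intro ln_le_minus_one) simp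
  then have *: "ln (1 + z) - ln (1 + a) \<le> (z - a) / (1 + a)"
    using assms by (simp add: ln_div field_simps)
  have "sqrt (ln (1 + z)) \<le> sqrt (ln (1 + a)) + (ln (1 + z) - ln (1 + a)) / (2 * sqrt (ln (1 + a)))"
    using assms by (intro sqrt_le_tangent) auto
  also have "(ln (1 + z) - ln (1 + a)) / (2 * sqrt (ln (1 + a)))
      \<le> (z - a) / (1 + a) / (2 * sqrt (ln (1 + a)))"
    using * assms by (intro divide_right_mono) auto
  finally show ?thesis by simp
qed

text \<open>Jensen's inequality by hand: the tangent at the quenched mean \<open>a\<close> dominates
  the function and averages to its value at \<open>a\<close>. Partial sums are used because finite
  sums later commute with the expectation over the environment.\<close>

lemma quenched_step_sqrt_ln_le:
  assumes p: "\<And>k. 0 \<le> p k" "p sums 1" "(\<lambda>k. real k * p k) sums \<mu>" and "0 < \<mu>" "1 \<le> x"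
  shows "(\<Sum>z<n. quenched_step p m x z * sqrt (ln (1 + real z)))
    \<le> sqrt (ln (1 + (real x * \<mu> + real m)))"
proof -
  define a where "a = real x * \<mu> + real m"
  define c where "c = 1 / ((1 + a) * (2 * sqrt (ln (1 + a))))"
  let ?q = "quenched_step p m x"
  have "a > 0" using assms by (simp add: a_def add_pos_nonneg)
  have nn: "0 \<le> ?q z" for z using quenched_step_nonneg p by blast
  have t: "sqrt (ln (1 + real z)) \<le> sqrt (ln (1 + a)) + (real z - a) * c" for z
    using sqrt_ln_le_tangent[OF \<open>a > 0\<close>, of "real z"] by (simp add: c_def)
  have "(\<lambda>z. ?q z * (sqrt (ln (1 + a)) - a * c) + c * (?q z * real z)) sums
      (1 * (sqrt (ln (1 + a)) - a * c) + c * a)"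
    unfolding a_def by (intro sums_add sums_mult2 sums_mult quenched_step_sums quenched_step_mean_sums p)
  then have S: "(\<lambda>z. ?q z * (sqrt (ln (1 + a)) + (real z - a) * c)) sums sqrt (ln (1 + a))"
    by (simp add: algebra_simps)
  \<comment> \<open>The tangent dominates a nonnegative function at every natural number, so partial
    sums of the majorant stay below its full sum.\<close>
  have nn': "0 \<le> ?q z * (sqrt (ln (1 + a)) + (real z - a) * c)" for z
    using t[of z] by (intro mult_nonneg_nonneg nn) (auto intro: order_trans[rotated])
  have "(\<Sum>z<n. ?q z * sqrt (ln (1 + real z)))
      \<le> (\<Sum>z<n. ?q z * (sqrt (ln (1 + a)) + (real z - a) * c))"
    by (intro sum_mono mult_left_mono t nn)
  also have "\<dots> \<le> sqrt (ln (1 + a))"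
    using sum_le_suminf[of "\<lambda>z. ?q z * (sqrt (ln (1 + a)) + (real z - a) * c)" "{..<n}"] S nn'
    by (auto simp: sums_iff)
  finally show ?thesis by (simp add: a_def)
qed

subsection \<open>Negative drift of the Lyapunov function\<close>

text \<open>With \<open>s = sqrt l\<close> and \<open>t = sqrt y\<close>, the factorisation of
  \<open>y - l\<close> as \<open>(t - s) * (t + s)\<close> reduces the last term to
  \<open>(t - s)\<^sup>2 / (2 * s)\<close>. The exact remainder allows its limit to be
  computed.\<close>

lemma sqrt_eq_tangent_minus:
  fixes y l :: real
  assumes "0 < l" "0 \<le> y"
  shows "sqrt y = sqrt l + (y - l) / (2 * sqrt l) - (y - l)\<^sup>2 / (2 * sqrt l * (sqrt y + sqrt l)\<^sup>2)"
proof -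
  define s t where "s = sqrt l" and "t = sqrt y"
  have st: "s > 0" "t \<ge> 0" "l = s\<^sup>2" "y = t\<^sup>2" using assms by (auto simp: s_def t_def)
  have "(y - l)\<^sup>2 = (t - s)\<^sup>2 * (t + s)\<^sup>2"
    unfolding st power_mult_distrib[symmetric] by (simp add: power2_eq_square algebra_simps)
  then have "(y - l)\<^sup>2 / (2 * s * (t + s)\<^sup>2) = (t - s)\<^sup>2 / (2 * s)"
    using st by simp
  moreover have "t = s + (t\<^sup>2 - s\<^sup>2) / (2 * s) - (t - s)\<^sup>2 / (2 * s)"
  proof -
    have "(t\<^sup>2 - s\<^sup>2) / (2 * s) - (t - s)\<^sup>2 / (2 * s) = (2 * s * (t - s)) / (2 * s)"
      unfolding diff_divide_distrib[symmetric] by (simp add: power2_eq_square algebra_simps)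
    then show ?thesis using st by simp
  qed
  ultimately show ?thesis using st by (simp add: s_def[symmetric] t_def[symmetric])
qed

text \<open>The bound is uniform in \<open>v\<close>, which supplies the dominating function for the
  immigration term. For \<open>u\<close> up to \<open>sqrt v\<close>, the factor
  \<open>1 / sqrt v\<close> absorbs \<open>ln v\<close>; for larger \<open>u\<close>,
  \<open>ln v\<close> is at most \<open>2 * ln (1 + u)\<close>.\<close>

lemma ln_times_ln_le:
  fixes u v :: real
  assumes "0 < u" "1 \<le> v"
  shows "ln v * ln (1 + u / v) \<le> 2 + 2 * (ln (1 + u))\<^sup>2"
proof (cases "u \<le> sqrt v")
  case True
  have s: "sqrt v \<ge> 1" "sqrt v * sqrt v = v" using assms by auto
  have "ln (1 + u / v) \<le> u / v" using assms by (intro ln_add_one_self_le_self) simp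
  also have "\<dots> \<le> sqrt v / v" using True assms by (intro divide_right_mono) auto
  also have "\<dots> = 1 / sqrt v" using s assms by (simp add: frac_eq_eq)
  finally have 1: "ln (1 + u / v) \<le> 1 / sqrt v" .
  have "ln (sqrt v) \<le> sqrt v" using s ln_le_minus_one[of "sqrt v"] by linarith
  then have 2: "ln v \<le> 2 * sqrt v" using assms by (simp add: ln_sqrt)
  have "ln v * ln (1 + u / v) \<le> 2 * sqrt v * (1 / sqrt v)"
    by (intro mult_mono 1 2) (use assms in auto)
  also have "\<dots> = 2" using s by simp
  finally show ?thesis by (smt (verit) zero_le_power2)
next
  case False
  have "ln (sqrt v) \<le> ln (1 + u)" using False assms by (intro ln_mono) auto
  then have 1: "ln v \<le> 2 * ln (1 + u)" using assms by (simp add: ln_sqrt)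
  have "u / v \<le> u" using assms by (simp add: divide_le_eq)
  then have 2: "ln (1 + u / v) \<le> ln (1 + u)" using assms by (intro ln_mono) (auto intro: add_pos_nonneg)
  have "ln v * ln (1 + u / v) \<le> 2 * ln (1 + u) * ln (1 + u)"
    by (intro mult_mono 1 2) (use assms in auto)
  then show ?thesis by (simp add: power2_eq_square)
qed

lemma sum3_sq_le: "((a::real) + b + 1)\<^sup>2 \<le> 3 * (a\<^sup>2 + b\<^sup>2 + 1)"
proof -
  have "0 \<le> (a - b)\<^sup>2 + (a - 1)\<^sup>2 + (b - 1)\<^sup>2" by simp
  then show ?thesis by (simp add: power2_eq_square algebra_simps)
qed

text \<open>The argument is at most \<open>(1 + m) * (1 + 1 / \<mu>)\<close>, and the second factor
  is at most twice the maximum of 1 and \<open>1 / \<mu>\<close>. This passes square integrability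
  from \<open>ln \<mu>\<close> and \<open>ln (1 + m)\<close> to the ratio.\<close>

lemma ln_ratio_le:
  fixes \<mu> m :: real
  assumes "0 < \<mu>" "0 \<le> m"
  shows "ln (1 + (m + 1) / \<mu>) \<le> ln (1 + m) + \<bar>ln \<mu>\<bar> + 1"
proof -
  have "1 + (m + 1) / \<mu> \<le> (1 + m) * (1 + 1 / \<mu>)"
    using assms by (simp add: field_simps)
  then have "ln (1 + (m + 1) / \<mu>) \<le> ln ((1 + m) * (1 + 1 / \<mu>))"
    using assms by (intro ln_mono) (auto intro!: add_pos_nonneg)
  also have "\<dots> = ln (1 + m) + ln (1 + 1 / \<mu>)"
    using assms by (intro ln_mult_pos) (auto intro!: add_pos_nonneg)
  also have "ln (1 + 1 / \<mu>) \<le> \<bar>ln \<mu>\<bar> + ln 2"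
  proof (cases "\<mu> \<ge> 1")
    case True
    then have "ln (1 + 1 / \<mu>) \<le> ln 2" using assms by (intro ln_mono) (auto intro!: add_pos_nonneg)
    then show ?thesis by simp
  next
    case False
    then have "ln (1 + 1 / \<mu>) \<le> ln (2 / \<mu>)"
      using assms by (intro ln_mono) (auto simp: field_simps intro!: add_pos_nonneg)
    then show ?thesis using assms by (simp add: ln_div)
  qed
  finally show ?thesis using ln_2_less_1 by simp
qed

text \<open>Enlarging \<open>x * \<mu>\<close> to \<open>(1 + x) * \<mu>\<close> lets
  \<open>(1 + x) * \<mu>\<close> factor out, separating the random-walk increment from the
  immigration correction.\<close>

lemma ln_ratio_decomp:
  fixes x \<mu> m :: real
  assumes "0 \<le> x" "0 < \<mu>" "0 \<le> m"
  shows "ln (1 + (x * \<mu> + m)) - ln (1 + x) \<le> ln \<mu> + ln (1 + (m + 1) / \<mu> / (1 + x))"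
proof -
  have pos: "0 < 1 + (m + 1) / \<mu> / (1 + x)" using assms by (intro add_pos_nonneg) auto
  have "1 + (x * \<mu> + m) \<le> (1 + x) * (\<mu> * (1 + (m + 1) / \<mu> / (1 + x)))"
  proof -
    have "(1 + x) * (\<mu> * (1 + c / \<mu> / (1 + x))) = (1 + x) * \<mu> + c" for c
    proof -
      have "(1 + x) * (\<mu> * (c / \<mu> / (1 + x))) = c" using assms by simp
      then show ?thesis by (simp only: distrib_left mult_1_right)
    qed
    from this[of "m + 1"] show ?thesis using assms by (simp only:) (simp add: algebra_simps)
  qed
  then have "ln (1 + (x * \<mu> + m)) \<le> ln ((1 + x) * (\<mu> * (1 + (m + 1) / \<mu> / (1 + x))))"
    using assms by (intro ln_mono) (auto intro: add_pos_nonneg)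
  also have "\<dots> = ln (1 + x) + (ln \<mu> + ln (1 + (m + 1) / \<mu> / (1 + x)))"
    using assms pos by (simp add: ln_mult_pos)
  finally show ?thesis by simp
qed

context prob_space
begin

text \<open>With \<open>L = ln (1 + x)\<close> and \<open>Y = ln (1 + x \<mu> + m)\<close>, second-order expansion of the square root
  around \<open>L\<close> gives the drift, up to the factor \<open>2 L \<surd>L\<close>, as \<open>L E(Y - L)\<close> minus a quadratic term.
  The former has upper limit at most \<open>0\<close> because \<open>E(ln \<mu>) = 0\<close>, while the latter stays bounded away from \<open>0\<close>
  because \<open>Y - L\<close> tends to \<open>ln \<mu>\<close>; truncating it at \<open>1\<close> makes dominated convergence available.\<close>

lemma sqrt_ln_supermartingale:
  fixes \<mu> m :: "'a \<Rightarrow> real"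
  assumes [measurable]: "\<mu> \<in> borel_measurable M" "m \<in> borel_measurable M"
    and \<mu>_pos: "AE \<omega> in M. 0 < \<mu> \<omega>" and m_nonneg: "\<And>\<omega>. 0 \<le> m \<omega>"
    and ln_\<mu>_sq: "integrable M (\<lambda>\<omega>. (ln (\<mu> \<omega>))\<^sup>2)" and ln_\<mu>_mean: "expectation (\<lambda>\<omega>. ln (\<mu> \<omega>)) = 0"
    and nondeg: "\<not> (AE \<omega> in M. \<mu> \<omega> = 1)"
    and ln_m_sq: "integrable M (\<lambda>\<omega>. (ln (1 + m \<omega>))\<^sup>2)"
  shows "\<forall>\<^sub>F x in sequentially. integrable M (\<lambda>\<omega>. sqrt (ln (1 + (real x * \<mu> \<omega> + m \<omega>)))) \<and>
    expectation (\<lambda>\<omega>. sqrt (ln (1 + (real x * \<mu> \<omega> + m \<omega>)))) \<le> sqrt (ln (1 + real x))"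
proof -
  define L where "L x = ln (1 + real x)" for x :: nat
  define X where "X \<omega> = ln (\<mu> \<omega>)" for \<omega>
  define Y where "Y x \<omega> = ln (1 + (real x * \<mu> \<omega> + m \<omega>))" for x \<omega>
  \<comment> \<open>\<open>R\<close> is the immigration correction scaled by \<open>L\<close>,
    \<open>B\<close> the truncated quadratic gain, \<open>B'\<close> its limit, and \<open>W\<close>
    a majorant of \<open>R x\<close> free of \<open>x\<close>.\<close>
  define R where "R x \<omega> = L x * ln (1 + (m \<omega> + 1) / \<mu> \<omega> / (1 + real x))" for x \<omega>
  define B where "B x \<omega> = min (L x * (Y x \<omega> - L x)\<^sup>2 / (sqrt (Y x \<omega>) + sqrt (L x))\<^sup>2) 1" for x \<omega>
  define B' where "B' \<omega> = min ((X \<omega>)\<^sup>2 / 4) 1" for \<omega>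
  define W where "W \<omega> = 2 + 2 * (ln (1 + (m \<omega> + 1) / \<mu> \<omega>))\<^sup>2" for \<omega>
  have [measurable]: "X \<in> borel_measurable M" "Y x \<in> borel_measurable M" "R x \<in> borel_measurable M"
    "B x \<in> borel_measurable M" "B' \<in> borel_measurable M" "W \<in> borel_measurable M" for x
    unfolding X_def Y_def R_def B_def B'_def W_def by measurable
  have L: "0 < L x" if "1 \<le> x" for x using that by (simp add: L_def)
  have intX: "integrable M X"
    using ln_\<mu>_sq by (subst X_def[abs_def], intro square_integrable_imp_integrable[of "\<lambda>\<omega>. ln (\<mu> \<omega>)"]) auto
  have intW: "integrable M W"
  proof (rule Bochner_Integration.integrable_bound)
    show "integrable M (\<lambda>\<omega>. 2 + 6 * ((ln (1 + m \<omega>))\<^sup>2 + (ln (\<mu> \<omega>))\<^sup>2 + 1))"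
      using ln_\<mu>_sq ln_m_sq by simp
    show "AE \<omega> in M. norm (W \<omega>) \<le> norm (2 + 6 * ((ln (1 + m \<omega>))\<^sup>2 + (ln (\<mu> \<omega>))\<^sup>2 + 1))"
      using \<mu>_pos
    proof eventually_elim
      case (elim \<omega>)
      have "(ln (1 + (m \<omega> + 1) / \<mu> \<omega>))\<^sup>2 \<le> (ln (1 + m \<omega>) + \<bar>ln (\<mu> \<omega>)\<bar> + 1)\<^sup>2"
        using elim m_nonneg[of \<omega>] by (intro power_mono ln_ratio_le) auto
      also have "\<dots> \<le> 3 * ((ln (1 + m \<omega>))\<^sup>2 + (ln (\<mu> \<omega>))\<^sup>2 + 1)"
        using sum3_sq_le[of "ln (1 + m \<omega>)" "\<bar>ln (\<mu> \<omega>)\<bar>"] by simp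
      finally show ?case by (simp add: W_def)
    qed
  qed simp
  have R_bound: "AE \<omega> in M. norm (R x \<omega>) \<le> W \<omega>" for x
    using \<mu>_pos
  proof eventually_elim
    case (elim \<omega>)
    have "0 \<le> R x \<omega>" using elim m_nonneg[of \<omega>] by (auto simp: R_def L_def intro!: mult_nonneg_nonneg)
    then show ?case
      using ln_times_ln_le[of "(m \<omega> + 1) / \<mu> \<omega>" "1 + real x"] elim m_nonneg[of \<omega>]
      by (simp add: R_def W_def L_def add_nonneg_pos)
  qed
  have R_lim: "AE \<omega> in M. (\<lambda>x. R x \<omega>) \<longlonglongrightarrow> 0"
    using \<mu>_pos
  proof eventually_elim
    case (elim \<omega>)
    define c where "c = (m \<omega> + 1) / \<mu> \<omega>"
    have "c > 0" using elim m_nonneg[of \<omega>] by (simp add: c_def add_nonneg_pos)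
    then have "(\<lambda>x::nat. ln (1 + real x) * ln (1 + c / (1 + real x))) \<longlonglongrightarrow> 0"
      by real_asymp
    then show ?case by (simp add: R_def L_def c_def)
  qed
  have intR: "integrable M (R x)" for x
    by (rule Bochner_Integration.integrable_bound[OF intW]) (use R_bound[of x] in auto)
  have intB: "integrable M (B x)" for x
  proof (rule integrable_const_bound[where B = 1])
    have "0 \<le> L x" by (simp add: L_def)
    then show "AE \<omega> in M. norm (B x \<omega>) \<le> 1" by (simp add: B_def)
  qed simp
  have B_lim: "AE \<omega> in M. (\<lambda>x. B x \<omega>) \<longlonglongrightarrow> B' \<omega>"
    using \<mu>_pos
  proof eventually_elim
    case (elim \<omega>)
    define a c where "a = \<mu> \<omega>" and "c = m \<omega>"
    have ac: "a > 0" "c \<ge> 0" using elim m_nonneg[of \<omega>] by (auto simp: a_def c_def)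
    have 1: "(\<lambda>x. Y x \<omega> - L x) \<longlonglongrightarrow> X \<omega>"
      unfolding Y_def L_def X_def a_def[symmetric] c_def[symmetric] using ac(1) by real_asymp
    have "(\<lambda>x. Y x \<omega> / L x) \<longlonglongrightarrow> 1"
      unfolding Y_def L_def a_def[symmetric] c_def[symmetric] using ac(1) by real_asymp
    then have 2: "(\<lambda>x. (Y x \<omega> - L x)\<^sup>2 / (sqrt (Y x \<omega> / L x) + 1)\<^sup>2) \<longlonglongrightarrow> (X \<omega>)\<^sup>2 / (sqrt 1 + 1)\<^sup>2"
      using 1 by (intro tendsto_intros) auto
    have "(\<lambda>x. L x * (Y x \<omega> - L x)\<^sup>2 / (sqrt (Y x \<omega>) + sqrt (L x))\<^sup>2) \<longlonglongrightarrow> (X \<omega>)\<^sup>2 / 4"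
    proof (rule Lim_transform_eventually)
      show "(\<lambda>x. (Y x \<omega> - L x)\<^sup>2 / (sqrt (Y x \<omega> / L x) + 1)\<^sup>2) \<longlonglongrightarrow> (X \<omega>)\<^sup>2 / 4"
        using 2 by simp
      show "\<forall>\<^sub>F x in sequentially. (Y x \<omega> - L x)\<^sup>2 / (sqrt (Y x \<omega> / L x) + 1)\<^sup>2
          = L x * (Y x \<omega> - L x)\<^sup>2 / (sqrt (Y x \<omega>) + sqrt (L x))\<^sup>2"
        using eventually_ge_at_top[of 1]
      proof eventually_elim
        case (elim x)
        \<comment> \<open>Extracting \<open>sqrt (L x)\<close> cancels the factor
          \<open>L x\<close>; only the ratio \<open>Y / L\<close> remains, whose limit 1 makes the
          denominator tend to 4.\<close>
        have "sqrt (Y x \<omega>) + sqrt (L x) = sqrt (L x) * (sqrt (Y x \<omega> / L x) + 1)"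
          using L[OF elim] by (simp add: real_sqrt_divide distrib_left)
        then show ?case using L[OF elim] by (simp add: power_mult_distrib)
      qed
    qed
    then show ?case unfolding B_def B'_def by (intro tendsto_min tendsto_const)
  qed
  have "(\<lambda>x. expectation (R x)) \<longlonglongrightarrow> expectation (\<lambda>_. 0)"
    by (rule integral_dominated_convergence[OF _ _ intW R_lim R_bound]) auto
  moreover have "(\<lambda>x. expectation (B x)) \<longlonglongrightarrow> expectation B'"
  proof (rule integral_dominated_convergence[OF _ _ _ B_lim, of "\<lambda>_. 1"])
    fix x
    have "0 \<le> L x" by (simp add: L_def)
    then show "AE \<omega> in M. norm (B x \<omega>) \<le> 1" by (simp add: B_def)
  qed auto
  ultimately have diff: "(\<lambda>x. expectation (R x) - expectation (B x)) \<longlonglongrightarrow> 0 - expectation B'"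
    by (intro tendsto_diff) auto
  have intB': "integrable M B'"
    by (rule integrable_const_bound[where B = 1]) (auto simp: B'_def)
  have "expectation B' > 0"
  proof -
    have "expectation B' \<ge> 0" by (simp add: B'_def)
    moreover have "expectation B' \<noteq> 0"
    proof
      assume "expectation B' = 0"
      then have "AE \<omega> in M. B' \<omega> = 0"
        using integral_nonneg_eq_0_iff_AE[OF intB'] by (simp add: B'_def)
      then have "AE \<omega> in M. \<mu> \<omega> = 1"
        \<comment> \<open>The truncated square vanishes only where \<open>ln \<mu>\<close> is 0,
          that is where \<open>\<mu>\<close> is 1.\<close>
        using \<mu>_pos by eventually_elim (auto simp: B'_def X_def min_def split: if_splits)
      then show False using nondeg by blast
    qed
    ultimately show ?thesis by simp
  qed
  then have "\<forall>\<^sub>F x in sequentially. expectation (R x) - expectation (B x) < 0"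
    by (intro order_tendstoD(2)[OF diff]) simp
  then show ?thesis using eventually_ge_at_top[of 1]
  proof eventually_elim
    case (elim x)
    note Lx = L[OF elim(2)]
    define c where "c = 1 / (2 * L x * sqrt (L x))"
    have c: "0 < c" using Lx by (simp add: c_def)
    \<comment> \<open>\<open>G\<close> is an integrable majorant of \<open>sqrt (Y x)\<close>; the
      term linear in \<open>X\<close> has mean 0, so only \<open>R\<close> and \<open>B\<close>
      affect its expectation.\<close>
    define G where "G \<omega> = sqrt (L x) + c * (L x * X \<omega> + R x \<omega> - B x \<omega>)" for \<omega>
    have intG: "integrable M G" unfolding G_def using intX intR intB by simp
    have le: "AE \<omega> in M. 0 \<le> sqrt (Y x \<omega>) \<and> sqrt (Y x \<omega>) \<le> G \<omega>"
      using \<mu>_pos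
    proof eventually_elim
      case (elim \<omega>)
      define y where "y = Y x \<omega>"
      have "0 \<le> y" using elim m_nonneg[of \<omega>] by (simp add: y_def Y_def)
      have r: "y - L x \<le> X \<omega> + R x \<omega> / L x"
        using ln_ratio_decomp[of "real x" "\<mu> \<omega>" "m \<omega>"] elim m_nonneg[of \<omega>] Lx
        by (simp add: y_def Y_def L_def X_def R_def)
      have r': "L x * (y - L x) \<le> L x * X \<omega> + R x \<omega>"
        using mult_left_mono[OF r, of "L x"] Lx by (simp add: distrib_left)
      have b: "B x \<omega> \<le> L x * (y - L x)\<^sup>2 / (sqrt y + sqrt (L x))\<^sup>2"
        by (simp add: B_def y_def)
      have e1: "c * (L x * (y - L x)) = (y - L x) / (2 * sqrt (L x))"
        using Lx by (simp add: c_def)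
      have e2: "c * (L x * (y - L x)\<^sup>2 / (sqrt y + sqrt (L x))\<^sup>2)
          = (y - L x)\<^sup>2 / (2 * sqrt (L x) * (sqrt y + sqrt (L x))\<^sup>2)"
        using Lx by (simp add: c_def)
      have "sqrt y = sqrt (L x) + c * (L x * (y - L x) - L x * (y - L x)\<^sup>2 / (sqrt y + sqrt (L x))\<^sup>2)"
        using sqrt_eq_tangent_minus[OF Lx \<open>0 \<le> y\<close>]
        unfolding right_diff_distrib[of c] e1 e2 by linarith
      also have "\<dots> \<le> sqrt (L x) + c * (L x * X \<omega> + R x \<omega> - B x \<omega>)"
        using c r' b by (intro add_left_mono mult_left_mono) auto
      finally show ?case using \<open>0 \<le> y\<close> by (simp add: G_def y_def)
    qed
    have intY: "integrable M (\<lambda>\<omega>. sqrt (Y x \<omega>))"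
      by (rule Bochner_Integration.integrable_bound[OF intG]) (use le in auto)
    have "expectation (\<lambda>\<omega>. sqrt (Y x \<omega>)) \<le> expectation G"
      by (rule integral_mono_AE[OF intY intG]) (use le in auto)
    also have "\<dots> = sqrt (L x) + c * (expectation (R x) - expectation (B x))"
      unfolding G_def using intX intR intB ln_\<mu>_mean[folded X_def] by (simp add: prob_space)
    also have "\<dots> \<le> sqrt (L x)" using c elim(1) by (simp add: mult_le_0_iff)
    finally show ?case using intY by (simp add: Y_def L_def)
  qed
qed

end

subsection \<open>The annealed kernel\<close>

lemma measurable_conv_pow:
  assumes [measurable]: "\<And>k. (\<lambda>\<omega>. p \<omega> k) \<in> borel_measurable N"
  shows "(\<lambda>\<omega>. conv_pow (p \<omega>) x n) \<in> borel_measurable N"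
proof (induction x arbitrary: n)
  case (Suc x)
  note [measurable] = Suc
  show ?case by (simp add: seq_conv_def)
qed simp

lemma measurable_quenched_step:
  assumes p [measurable]: "\<And>k. (\<lambda>\<omega>. p \<omega> k) \<in> borel_measurable N"
    and [measurable]: "m \<in> measurable N (count_space UNIV)"
  shows "(\<lambda>\<omega>. quenched_step (p \<omega>) (m \<omega>) x z) \<in> borel_measurable N"
proof -
  \<comment> \<open>Immigration above \<open>z\<close> contributes nothing, so the random index is
    resolved into finitely many measurable cases.\<close>
  have eq: "quenched_step (p \<omega>) (m \<omega>) x z
      = (\<Sum>i\<le>z. if m \<omega> = i then conv_pow (p \<omega>) x (z - i) else 0)" for \<omega>
    by (simp add: quenched_step_def)
  note [measurable] = measurable_conv_pow[OF p]
  show ?thesis unfolding eq by measurable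
qed

lemma ln_one_plus_le_log_plus: "ln (1 + real n) \<le> log_plus (real n) + 1"
proof (cases "n = 0")
  case False
  then have "ln (1 + real n) \<le> ln (2 * real n)" by (intro ln_mono) auto
  also have "\<dots> = ln 2 + ln (real n)" using False by (simp add: ln_mult_pos)
  also have "ln (real n) = log_plus (real n)" using False by (cases "n = 1") (auto simp: log_plus_def)
  finally show ?thesis using ln_2_less_1 by simp
qed (simp add: log_plus_def)

lemma square_le_one_plus_powr:
  fixes t :: real
  assumes "0 \<le> t" "0 < \<epsilon>"
  shows "t\<^sup>2 \<le> 1 + t powr (2 + \<epsilon>)"
proof (cases "t \<le> 1")
  case True
  then have "t\<^sup>2 \<le> 1" using assms by (simp add: power_le_one)
  then show ?thesis by (smt (verit) powr_ge_zero)
next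
  case False
  then have "t\<^sup>2 = t powr 2" by (simp add: powr_numeral)
  also have "\<dots> \<le> t powr (2 + \<epsilon>)" using False assms by (intro powr_mono) auto
  finally show ?thesis by simp
qed

theorem theorem1p2:
  fixes Q :: "'w measure"
    and p :: "nat \<Rightarrow> 'w \<Rightarrow> nat \<Rightarrow> real"
    and M :: "nat \<Rightarrow> 'w \<Rightarrow> nat"
    and S :: "nat set"
  assumes Q: "prob_space Q"
    and env_meas: "\<And>n. n \<ge> 1 \<Longrightarrow> (\<lambda>\<omega>. (p n \<omega>, M n \<omega>))
                 \<in> measurable Q ((\<Pi>\<^sub>M k\<in>UNIV. borel) \<Otimes>\<^sub>M count_space UNIV)"
    and offspring: "\<And>n \<omega>. n \<ge> 1 \<Longrightarrow> \<omega> \<in> space Q \<Longrightarrow>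
                 (\<forall>k. 0 \<le> p n \<omega> k) \<and> p n \<omega> sums 1"
    and iid_indep: "prob_space.indep_vars Q (\<lambda>_. (\<Pi>\<^sub>M k\<in>UNIV. borel) \<Otimes>\<^sub>M count_space UNIV)
                 (\<lambda>n \<omega>. (p n \<omega>, M n \<omega>)) {1..}"
    and iid_distr: "\<And>n. n \<ge> 1 \<Longrightarrow>
                 distr Q ((\<Pi>\<^sub>M k\<in>UNIV. borel) \<Otimes>\<^sub>M count_space UNIV) (\<lambda>\<omega>. (p n \<omega>, M n \<omega>))
               = distr Q ((\<Pi>\<^sub>M k\<in>UNIV. borel) \<Otimes>\<^sub>M count_space UNIV) (\<lambda>\<omega>. (p 1 \<omega>, M 1 \<omega>))"
    and mu_fin_pos: "AE \<omega> in Q. summable (\<lambda>k. real k * p 1 \<omega> k) \<and> 0 < offspring_mean (p 1 \<omega>)"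
    and log_mu_L2: "integrable Q (\<lambda>\<omega>. (ln (offspring_mean (p 1 \<omega>)))\<^sup>2)"
    and log_mu_centered: "(\<integral>\<omega>. ln (offspring_mean (p 1 \<omega>)) \<partial>Q) = 0"
    and mu_nondeg: "measure Q {\<omega> \<in> space Q. offspring_mean (p 1 \<omega>) = 1} < 1"
    and immig: "\<exists>\<epsilon>>0. integrable Q (\<lambda>\<omega>. log_plus (real (M 1 \<omega>)) powr (2 + \<epsilon>))"
    and S: "S = UNIV \<or> S = {1..}"
    and irred: "irreducible_on S (bpire_kernel Q p M)"
  shows "\<forall>x\<in>S. recurrent_state (bpire_kernel Q p M) x"
proof
  fix y assume "y \<in> S"
  interpret prob_space Q by (rule Q)
  define \<mu> where "\<mu> \<omega> = offspring_mean (p 1 \<omega>)" for \<omega>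
  define m where "m \<omega> = real (M 1 \<omega>)" for \<omega>
  let ?K = "bpire_kernel Q p M"
  let ?q = "\<lambda>\<omega>. quenched_step (p 1 \<omega>) (M 1 \<omega>)"
  let ?f = "\<lambda>z::nat. sqrt (ln (1 + real z))"
  note env = env_meas[of 1, simplified]
  have p1: "(\<lambda>\<omega>. p 1 \<omega>) \<in> measurable Q (\<Pi>\<^sub>M k\<in>UNIV. borel)"
    using measurable_compose[OF env measurable_fst] by simp
  have [measurable]: "(\<lambda>\<omega>. p 1 \<omega> k) \<in> borel_measurable Q" for k
    using measurable_compose[OF p1 measurable_component_singleton[of k UNIV]] by simp
  have M1 [measurable]: "M 1 \<in> measurable Q (count_space UNIV)"
    using measurable_compose[OF env measurable_snd] by simp
  have [measurable]: "\<mu> \<in> borel_measurable Q" "m \<in> borel_measurable Q"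
    unfolding \<mu>_def m_def offspring_mean_def by measurable
  have q_meas [measurable]: "(\<lambda>\<omega>. ?q \<omega> x z) \<in> borel_measurable Q" for x z
    by (rule measurable_quenched_step) measurable
  have off: "0 \<le> p 1 \<omega> k" "p 1 \<omega> sums 1" if "\<omega> \<in> space Q" for \<omega> k
    using offspring[OF _ that, of 1] by auto
  have q_nonneg: "0 \<le> ?q \<omega> x z" if "\<omega> \<in> space Q" for \<omega> x z
    using off[OF that] by (intro quenched_step_nonneg) auto
  have q_sums: "?q \<omega> x sums 1" if "\<omega> \<in> space Q" for \<omega> x
    using off[OF that] by (intro quenched_step_sums) auto
  have q_part: "(\<Sum>z<n. ?q \<omega> x z) \<le> 1" if "\<omega> \<in> space Q" for \<omega> x n
    using sum_le_suminf[of "?q \<omega> x" "{..<n}"] q_sums[OF that, of x] q_nonneg[OF that]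
    by (auto simp: sums_iff)
  have q_le1: "?q \<omega> x z \<le> 1" if "\<omega> \<in> space Q" for \<omega> x z
    using sum_le_suminf[of "?q \<omega> x" "{z}"] q_sums[OF that, of x] q_nonneg[OF that]
    by (auto simp: sums_iff)
  have q_int: "integrable Q (\<lambda>\<omega>. ?q \<omega> x z)" for x z
    by (rule integrable_const_bound[where B = 1, OF _ q_meas])
       (use q_nonneg q_le1 in auto)
  have K_nonneg: "0 \<le> ?K x z" for x z
    unfolding bpire_kernel_def using q_nonneg by (intro integral_nonneg_AE) auto
  interpret stochastic_kernel ?K
  proof
    fix x
    have meas: "(\<lambda>\<omega>. \<Sum>z<n. ?q \<omega> x z) \<in> borel_measurable Q" for n
      by measurable
    \<comment> \<open>Summation over \<open>z\<close> and expectation are exchanged by dominated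
      convergence, the quenched partial sums being at most 1.\<close>
    have "(\<lambda>n. \<integral>\<omega>. (\<Sum>z<n. ?q \<omega> x z) \<partial>Q) \<longlonglongrightarrow> (\<integral>\<omega>. 1 \<partial>Q)"
      by (rule integral_dominated_convergence[where w = "\<lambda>_. 1", OF _ meas])
         (use q_part q_nonneg q_sums in \<open>auto simp: sums_def sum_nonneg\<close>)
    then show "?K x sums 1"
      using q_int by (simp add: sums_def bpire_kernel_def prob_space)
  qed (rule K_nonneg)
  have ln_m_sq: "integrable Q (\<lambda>\<omega>. (ln (1 + m \<omega>))\<^sup>2)"
  proof -
    obtain \<epsilon> where \<epsilon>: "\<epsilon> > 0" "integrable Q (\<lambda>\<omega>. log_plus (real (M 1 \<omega>)) powr (2 + \<epsilon>))"
      using immig by blast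
    show ?thesis
    proof (rule Bochner_Integration.integrable_bound)
      show "integrable Q (\<lambda>\<omega>. 4 + 2 * log_plus (real (M 1 \<omega>)) powr (2 + \<epsilon>))"
        using \<epsilon> by simp
      \<comment> \<open>The constants come from
        \<open>(t + 1)\<^sup>2 \<le> 2 * t\<^sup>2 + 2\<close> combined with
        \<open>t\<^sup>2 \<le> 1 + t powr (2 + \<epsilon>)\<close>.\<close>
      have "(ln (1 + real n))\<^sup>2 \<le> 4 + 2 * log_plus (real n) powr (2 + \<epsilon>)" for n
      proof -
        define t where "t = log_plus (real n)"
        have t: "0 \<le> t" by (simp add: t_def log_plus_def)
        have "(ln (1 + real n))\<^sup>2 \<le> (t + 1)\<^sup>2"
          unfolding t_def by (intro power_mono ln_one_plus_le_log_plus) auto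
        also have "\<dots> \<le> 2 * t\<^sup>2 + 2"
          using sum_squares_bound[of t 1] by (simp add: power2_eq_square algebra_simps)
        finally show ?thesis
          using square_le_one_plus_powr[OF t \<epsilon>(1)] by (simp add: t_def)
      qed
      then show "AE \<omega> in Q. norm ((ln (1 + m \<omega>))\<^sup>2)
          \<le> norm (4 + 2 * log_plus (real (M 1 \<omega>)) powr (2 + \<epsilon>))"
        by (simp add: m_def)
    qed simp
  qed
  have nondeg: "\<not> (AE \<omega> in Q. \<mu> \<omega> = 1)"
  proof
    assume "AE \<omega> in Q. \<mu> \<omega> = 1"
    then have "prob {\<omega> \<in> space Q. \<mu> \<omega> = 1} = 1" by (intro prob_Collect_eq_1[THEN iffD2]) simp_all
    then show False using mu_nondeg by (simp add: \<mu>_def)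
  qed
  have "\<forall>\<^sub>F x in sequentially. integrable Q (\<lambda>\<omega>. sqrt (ln (1 + (real x * \<mu> \<omega> + m \<omega>)))) \<and>
      expectation (\<lambda>\<omega>. sqrt (ln (1 + (real x * \<mu> \<omega> + m \<omega>)))) \<le> ?f x"
  proof (rule sqrt_ln_supermartingale)
    show "AE \<omega> in Q. 0 < \<mu> \<omega>" using mu_fin_pos unfolding \<mu>_def by eventually_elim blast
    show "integrable Q (\<lambda>\<omega>. (ln (\<mu> \<omega>))\<^sup>2)" "expectation (\<lambda>\<omega>. ln (\<mu> \<omega>)) = 0"
      unfolding \<mu>_def by (rule log_mu_L2, rule log_mu_centered)
    show "0 \<le> m \<omega>" for \<omega> by (simp add: m_def)
  qed (use nondeg ln_m_sq in simp_all)
  then obtain x1 where x1: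
    "integrable Q (\<lambda>\<omega>. sqrt (ln (1 + (real x * \<mu> \<omega> + m \<omega>))))"
    "expectation (\<lambda>\<omega>. sqrt (ln (1 + (real x * \<mu> \<omega> + m \<omega>)))) \<le> ?f x" if "x \<ge> x1" for x
    unfolding eventually_sequentially by blast
  show "recurrent_state ?K y"
  \<comment> \<open>The threshold combines \<open>x1\<close> from the drift estimate with 1, which
    keeps the quenched mean positive for Jensen's inequality.\<close>
  proof (rule foster_recurrence[OF irred \<open>y \<in> S\<close>, of ?f "max 1 x1"])
    show "filterlim ?f at_top sequentially" by real_asymp
  next
    fix x assume "max 1 x1 \<le> x"
    then have x: "1 \<le> x" "x1 \<le> x" by auto
    \<comment> \<open>A bound on all partial sums yields both the summability and the value bound
      that the Foster criterion requires.\<close>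
    have part: "(\<Sum>z<n. ?K x z * ?f z) \<le> ?f x" for n
    proof -
      have "(\<Sum>z<n. ?K x z * ?f z) = expectation (\<lambda>\<omega>. \<Sum>z<n. ?q \<omega> x z * ?f z)"
        using q_int by (simp add: bpire_kernel_def)
      also have "\<dots> \<le> expectation (\<lambda>\<omega>. sqrt (ln (1 + (real x * \<mu> \<omega> + m \<omega>))))"
      proof (rule integral_mono_AE)
        show "AE \<omega> in Q. (\<Sum>z<n. ?q \<omega> x z * ?f z) \<le> sqrt (ln (1 + (real x * \<mu> \<omega> + m \<omega>)))"
          using mu_fin_pos AE_space
        proof eventually_elim
          case (elim \<omega>)
          then show ?case unfolding m_def
            using off[OF elim(2)] x
            by (intro quenched_step_sqrt_ln_le) (auto simp: \<mu>_def offspring_mean_def summable_sums)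
        qed
      qed (use q_int x1(1)[OF x(2)] in auto)
      also note x1(2)[OF x(2)]
      finally show ?thesis .
    qed
    have "summable (\<lambda>z. ?K x z * ?f z)"
      by (rule summableI_nonneg_bounded[OF _ part]) (simp add: K_nonneg)
    then show "summable (\<lambda>z. ?K x z * ?f z) \<and> (\<Sum>z. ?K x z * ?f z) \<le> ?f x"
      using suminf_le_const[OF _ part] by blast
  qed simp
qed

end
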